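(* Fix integers $M,N\ge1$, and consider the ring $\mathbb{C}^{M\times N}$ with the convolution product $\diamond$ and the usual matrix sum. Then the Cayley--Hamilton degree of this ring is $M+N-1$; that is, $M+N-1$ is the smallest integer $\kappa\ge1$ such that for every $A\in\mathbb{C}^{M\times N}$ there is a monic polynomial $p\in\mathbb{C}[z]$ of degree $\kappa$ with $p_\diamond(A)=0$. Moreover, for any $A=(a_{ij})\in\mathbb{C}^{M\times N}$, the polynomial $$p_A(z):=(z-a_{00})^{M+N-1}$$ is a Cayley--Hamilton polynomial for $A$, i.e. a monic polynomial of this degree with $(p_A)_\diamond(A)=0$.
   Context: Matrices in $\mathbb{C}^{M\times N}$ are indexed by $(i,j)$ with $0\le i\le M-1$, $0\le j\le N-1$. The convolution (Jury product) of $A=(a_{ij}),B=(b_{ij})\in\mathbb{C}^{M\times N}$ is the matrix $A\diamond B\in\mathbb{C}^{M\times N}$ with $$(A\diamond B)_{ij}:=\sum_{\ell=0}^i\sum_{\kappa=0}^j a_{\ell,\kappa}\,b_{i-\ell,j-\kappa}.$$ It is commutative and associative, with identity $\mathrm{I}_\diamond$, the matrix with $(0,0)$ entry $1$ and all other entries $0$. Powers: $A^{\diamond0}:=\mathrm{I}_\diamond$, $A^{\diamond k}:=A\diamond\cdots\diamond A$ ($k$ factors). For $p(z)=c_0+c_1z+\dots+c_nz^n\in\mathbb{C}[z]$, $p_\diamond(A):=c_0\mathrm{I}_\diamond+c_1A+c_2A^{\diamond2}+\dots+c_nA^{\diamond n}$. *)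

theory Defs
  imports "Jordan_Normal_Form.Matrix" "HOL-Computational_Algebra.Polynomial"
begin

definition jury_mult :: "nat \<Rightarrow> nat \<Rightarrow> complex mat \<Rightarrow> complex mat \<Rightarrow> complex mat" where
  "jury_mult M N A B =
     mat M N (\<lambda>(i, j). \<Sum>l\<le>i. \<Sum>k\<le>j. A $$ (l, k) * B $$ (i - l, j - k))"

definition jury_one :: "nat \<Rightarrow> nat \<Rightarrow> complex mat" where
  "jury_one M N = mat M N (\<lambda>(i, j). if i = 0 \<and> j = 0 then 1 else 0)"

text \<open>The multiplication of \<open>jury_ring\<close> is the convolution, not the usual matrix product.  The
  field \<open>smult\<close> must be qualified because \<^const>\<open>Polynomial.smult\<close> shadows it.\<close>

definition jury_ring :: "nat \<Rightarrow> nat \<Rightarrow> (complex, complex mat) module" where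
  "jury_ring M N =
     \<lparr>carrier = carrier_mat M N, mult = jury_mult M N, one = jury_one M N,
      zero = 0\<^sub>m M N, add = (+), module.smult = (\<cdot>\<^sub>m)\<rparr>"

definition poly_at :: "(complex, 'b, 'm) module_scheme \<Rightarrow> complex poly \<Rightarrow> 'b \<Rightarrow> 'b" where
  "poly_at R p a = (\<Oplus>\<^bsub>R\<^esub>k\<in>{..degree p}. coeff p k \<odot>\<^bsub>R\<^esub> (a [^]\<^bsub>R\<^esub> k))"

definition cayley_hamilton_poly ::
    "(complex, 'b, 'm) module_scheme \<Rightarrow> nat \<Rightarrow> 'b \<Rightarrow> complex poly \<Rightarrow> bool" where
  "cayley_hamilton_poly R d a p \<longleftrightarrow>
     lead_coeff p = 1 \<and> degree p = d \<and> poly_at R p a = \<zero>\<^bsub>R\<^esub>"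

definition cayley_hamilton_at :: "(complex, 'b, 'm) module_scheme \<Rightarrow> nat \<Rightarrow> bool" where
  "cayley_hamilton_at R d \<longleftrightarrow> (\<forall>a\<in>carrier R. \<exists>p. cayley_hamilton_poly R d a p)"

definition is_cayley_hamilton_degree :: "(complex, 'b, 'm) module_scheme \<Rightarrow> nat \<Rightarrow> bool" where
  "is_cayley_hamilton_degree R d \<longleftrightarrow>
     1 \<le> d \<and> cayley_hamilton_at R d \<and> (\<forall>k\<ge>1. cayley_hamilton_at R k \<longrightarrow> d \<le> k)"

text \<open>The finite sum and the powers in \<^const>\<open>poly_at\<close> have their intended meaning
  in \<^term>\<open>jury_ring M N\<close> because it is a commutative ring.\<close>

lemma jury_ring_simps:
  "carrier (jury_ring M N) = carrier_mat M N"
  "mult (jury_ring M N) = jury_mult M N"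
  "one (jury_ring M N) = jury_one M N"
  "zero (jury_ring M N) = 0\<^sub>m M N"
  "add (jury_ring M N) = (+)"
  "module.smult (jury_ring M N) = (\<cdot>\<^sub>m)"
  by (simp_all add: jury_ring_def)

lemma jury_mult_carrier [simp]: "jury_mult M N A B \<in> carrier_mat M N"
  by (simp add: jury_mult_def)

lemma jury_one_carrier [simp]: "jury_one M N \<in> carrier_mat M N"
  by (simp add: jury_one_def)

lemma jury_mult_index:
  "i < M \<Longrightarrow> j < N \<Longrightarrow>
   jury_mult M N A B $$ (i, j) = (\<Sum>l\<le>i. \<Sum>k\<le>j. A $$ (l, k) * B $$ (i - l, j - k))"
  by (simp add: jury_mult_def)

lemma convolution_assoc:
  fixes f g h :: "nat \<Rightarrow> nat \<Rightarrow> complex"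
  shows "(\<Sum>l\<le>i. \<Sum>k\<le>j. (\<Sum>a\<le>l. \<Sum>b\<le>k. f a b * g (l - a) (k - b)) * h (i - l) (j - k)) =
         (\<Sum>a\<le>i. \<Sum>b\<le>j. f a b * (\<Sum>l\<le>i - a. \<Sum>k\<le>j - b. g l k * h (i - a - l) (j - b - k)))"
proof -
  have tri: "(\<Sum>l\<le>n. \<Sum>a\<le>l. F a (l - a) (n - l)) = (\<Sum>a\<le>n. \<Sum>l\<le>n - a. F a l (n - a - l))"
    for n and F :: "nat \<Rightarrow> nat \<Rightarrow> nat \<Rightarrow> complex"
  proof -
    have "(\<Sum>l\<le>n. \<Sum>a\<le>l. F a (l - a) (n - l)) =
          (\<Sum>(l, a)\<in>(SIGMA l:{..n}. {..l}). F a (l - a) (n - l))"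
      by (simp add: sum.Sigma)
    also have "\<dots> = (\<Sum>(a, l)\<in>(SIGMA a:{..n}. {..n - a}). F a l (n - a - l))"
      by (rule sum.reindex_bij_witness[where i = "\<lambda>(a, l). (a + l, a)" and j = "\<lambda>(l, a). (a, l - a)"])
        auto
    finally show ?thesis by (simp add: sum.Sigma)
  qed
  have "(\<Sum>l\<le>i. \<Sum>k\<le>j. (\<Sum>a\<le>l. \<Sum>b\<le>k. f a b * g (l - a) (k - b)) * h (i - l) (j - k)) =
        (\<Sum>l\<le>i. \<Sum>a\<le>l. \<Sum>k\<le>j. \<Sum>b\<le>k. f a b * g (l - a) (k - b) * h (i - l) (j - k))"
    by (simp add: sum_distrib_right sum.swap[of _ "{.._}" "{..j}"])
  also have "\<dots> = (\<Sum>l\<le>i. \<Sum>a\<le>l. \<Sum>b\<le>j. \<Sum>k\<le>j - b. f a b * g (l - a) k * h (i - l) (j - b - k))"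
    by (intro sum.cong refl tri)
  also have "\<dots> = (\<Sum>a\<le>i. \<Sum>l\<le>i - a. \<Sum>b\<le>j. \<Sum>k\<le>j - b. f a b * g l k * h (i - a - l) (j - b - k))"
    by (rule tri)
  also have "\<dots> = (\<Sum>a\<le>i. \<Sum>b\<le>j. \<Sum>l\<le>i - a. \<Sum>k\<le>j - b. f a b * g l k * h (i - a - l) (j - b - k))"
    by (intro sum.cong refl sum.swap)
  finally show ?thesis
    by (simp add: sum_distrib_left mult.assoc)
qed

lemma jury_mult_assoc:
  "jury_mult M N (jury_mult M N A B) C = jury_mult M N A (jury_mult M N B C)"
proof (rule eq_matI)
  fix i j assume "i < dim_row (jury_mult M N A (jury_mult M N B C))"
    and "j < dim_col (jury_mult M N A (jury_mult M N B C))"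
  then have ij: "i < M" "j < N" by (auto simp: jury_mult_def)
  then show "jury_mult M N (jury_mult M N A B) C $$ (i, j) =
             jury_mult M N A (jury_mult M N B C) $$ (i, j)"
    using convolution_assoc[where f = "\<lambda>a b. A $$ (a, b)" and g = "\<lambda>a b. B $$ (a, b)" and h = "\<lambda>a b. C $$ (a, b)"
        and i = i and j = j]
    by (simp add: jury_mult_index)
qed (auto simp: jury_mult_def)

lemma jury_mult_comm: "jury_mult M N A B = jury_mult M N B A"
proof -
  have rev: "(\<Sum>l\<le>n. F l (n - l)) = (\<Sum>l\<le>n. F (n - l) l)"
    for n :: nat and F :: "nat \<Rightarrow> nat \<Rightarrow> complex"
    by (rule sum.reindex_bij_witness[where i = "\<lambda>l. n - l" and j = "\<lambda>l. n - l"]) auto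
  have "(\<Sum>l\<le>i. \<Sum>k\<le>j. A $$ (l, k) * B $$ (i - l, j - k)) =
        (\<Sum>l\<le>i. \<Sum>k\<le>j. B $$ (l, k) * A $$ (i - l, j - k))" for i j
  proof -
    have "(\<Sum>l\<le>i. \<Sum>k\<le>j. A $$ (l, k) * B $$ (i - l, j - k)) =
          (\<Sum>l\<le>i. \<Sum>k\<le>j. A $$ (i - l, k) * B $$ (l, j - k))"
      by (rule rev)
    also have "\<dots> = (\<Sum>l\<le>i. \<Sum>k\<le>j. A $$ (i - l, j - k) * B $$ (l, k))"
      by (intro sum.cong refl rev)
    finally show ?thesis by (simp add: mult.commute)
  qed
  then show ?thesis by (simp add: jury_mult_def)
qed

lemma jury_mult_one: "A \<in> carrier_mat M N \<Longrightarrow> jury_mult M N (jury_one M N) A = A"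
proof (rule eq_matI)
  fix i j assume A: "A \<in> carrier_mat M N" and "i < dim_row A" "j < dim_col A"
  then have ij: "i < M" "j < N" by auto
  then have "jury_mult M N (jury_one M N) A $$ (i, j) =
     (\<Sum>l\<le>i. \<Sum>k\<le>j. if k = 0 then if l = 0 then A $$ (i - l, j - k) else 0 else 0)"
    unfolding jury_mult_index[OF ij] by (intro sum.cong refl) (auto simp: jury_one_def)
  then show "jury_mult M N (jury_one M N) A $$ (i, j) = A $$ (i, j)"
    by (simp add: sum.delta)
qed (auto simp: jury_mult_def)

lemma jury_mult_add:
  assumes "A \<in> carrier_mat M N" "B \<in> carrier_mat M N"
  shows "jury_mult M N (A + B) C = jury_mult M N A C + jury_mult M N B C"
proof (rule eq_matI)
  fix i j assume "i < dim_row (jury_mult M N A C + jury_mult M N B C)"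
    and "j < dim_col (jury_mult M N A C + jury_mult M N B C)"
  then have ij: "i < M" "j < N" by (auto simp: jury_mult_def)
  then have "jury_mult M N (A + B) C $$ (i, j) =
     (\<Sum>l\<le>i. \<Sum>k\<le>j. A $$ (l, k) * C $$ (i - l, j - k) + B $$ (l, k) * C $$ (i - l, j - k))"
    unfolding jury_mult_index[OF ij] using assms
    by (intro sum.cong refl) (auto simp: algebra_simps)
  also have "\<dots> = jury_mult M N A C $$ (i, j) + jury_mult M N B C $$ (i, j)"
    by (simp add: jury_mult_index ij sum.distrib)
  finally show "jury_mult M N (A + B) C $$ (i, j) = (jury_mult M N A C + jury_mult M N B C) $$ (i, j)"
    using ij by (simp add: jury_mult_def)
qed (auto simp: jury_mult_def)

lemma jury_ring_cring: "cring (jury_ring M N)"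
proof (rule cringI)
  show "abelian_group (jury_ring M N)"
    by unfold_locales
      (insert add_inv_exists_mat, auto simp: jury_ring_def Units_def)
  show "comm_monoid (jury_ring M N)"
    by (rule comm_monoidI)
      (auto simp: jury_ring_simps jury_mult_one jury_mult_assoc intro: jury_mult_comm)
qed (auto simp: jury_ring_simps jury_mult_add)

end

theory Submission
  imports Defs
begin

text \<open>The ring \<open>jury_ring M N\<close> is the quotient of $\mathbb{C}[x, y]$ by $(x^M, y^N)$.
  Hence $(A - a_{00})^{M+N-1}$ has only monomials of total degree at least $M+N-1$, all of which
  lie in the ideal, whereas in a monic polynomial of degree $k < M+N-1$ evaluated at $x + y$ some
  monomial of total degree $k$ survives, with a binomial coefficient.\<close>

text \<open>The quotient map of the overview: the outer variable x counts rows, the inner variable y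
  counts columns.\<close>

definition jury_trunc :: "nat \<Rightarrow> nat \<Rightarrow> complex poly poly \<Rightarrow> complex mat" where
  "jury_trunc M N P = mat M N (\<lambda>(i, j). coeff (coeff P i) j)"

lemma jury_trunc_carrier [simp]: "jury_trunc M N P \<in> carrier_mat M N"
  by (simp add: jury_trunc_def)

lemma jury_trunc_index: "i < M \<Longrightarrow> j < N \<Longrightarrow> jury_trunc M N P $$ (i, j) = coeff (coeff P i) j"
  by (simp add: jury_trunc_def)

lemma jury_trunc_surj:
  assumes "A \<in> carrier_mat M N"
  obtains P where "A = jury_trunc M N P"
proof
  let ?P = "\<Sum>i<M. monom (\<Sum>j<N. monom (A $$ (i, j)) j) i"
  show "A = jury_trunc M N ?P"
  proof (rule eq_matI)
    fix i j
    assume "i < dim_row (jury_trunc M N ?P)" "j < dim_col (jury_trunc M N ?P)"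
    then have ij: "i < M" "j < N" by (auto simp: jury_trunc_def)
    have "coeff ?P i = (\<Sum>j<N. monom (A $$ (i, j)) j)"
      using ij by (simp add: coeff_sum)
    then show "A $$ (i, j) = jury_trunc M N ?P $$ (i, j)"
      using ij by (simp add: jury_trunc_index coeff_sum)
  qed (use assms in \<open>auto simp: jury_trunc_def\<close>)
qed

lemma jury_trunc_0: "jury_trunc M N 0 = \<zero>\<^bsub>jury_ring M N\<^esub>"
  by (auto simp: jury_ring_simps jury_trunc_def)

lemma jury_trunc_add:
  "jury_trunc M N (P + Q) = jury_trunc M N P \<oplus>\<^bsub>jury_ring M N\<^esub> jury_trunc M N Q"
  by (auto simp: jury_ring_simps jury_trunc_def)

lemma jury_trunc_smult:
  "jury_trunc M N (Polynomial.smult [:c:] P) = c \<odot>\<^bsub>jury_ring M N\<^esub> jury_trunc M N P"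
  by (auto simp: jury_ring_simps jury_trunc_def)

text \<open>Truncation loses nothing here: entry (i, j) of a Cauchy product in both variables only
  involves indices up to i and j.\<close>

lemma jury_trunc_mult:
  "jury_trunc M N (P * Q) = jury_trunc M N P \<otimes>\<^bsub>jury_ring M N\<^esub> jury_trunc M N Q"
proof (rule eq_matI)
  fix i j
  assume "i < dim_row (jury_trunc M N P \<otimes>\<^bsub>jury_ring M N\<^esub> jury_trunc M N Q)"
    "j < dim_col (jury_trunc M N P \<otimes>\<^bsub>jury_ring M N\<^esub> jury_trunc M N Q)"
  then have ij: "i < M" "j < N" by (auto simp: jury_ring_simps jury_mult_def)
  then show "jury_trunc M N (P * Q) $$ (i, j) =
      (jury_trunc M N P \<otimes>\<^bsub>jury_ring M N\<^esub> jury_trunc M N Q) $$ (i, j)"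
    by (simp add: jury_ring_simps jury_mult_index jury_trunc_index coeff_mult coeff_sum)
qed (auto simp: jury_ring_simps jury_mult_def jury_trunc_def)

lemma jury_trunc_1: "jury_trunc M N 1 = \<one>\<^bsub>jury_ring M N\<^esub>"
  by (auto simp: jury_ring_simps jury_trunc_def jury_one_def coeff_1)

lemma jury_trunc_power: "jury_trunc M N (P ^ k) = jury_trunc M N P [^]\<^bsub>jury_ring M N\<^esub> k"
proof -
  interpret cring "jury_ring M N" by (rule jury_ring_cring)
  show ?thesis
    by (induction k) (simp_all only: power_0 power_Suc2 nat_pow_0 nat_pow_Suc jury_trunc_1 jury_trunc_mult)
qed

lemma jury_trunc_sum:
  assumes "finite S"
  shows "jury_trunc M N (\<Sum>k\<in>S. F k) = (\<Oplus>\<^bsub>jury_ring M N\<^esub>k\<in>S. jury_trunc M N (F k))"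
proof -
  interpret cring "jury_ring M N" by (rule jury_ring_cring)
  have [simp]: "jury_trunc M N P \<in> carrier (jury_ring M N)" for P
    by (simp add: jury_ring_simps)
  show ?thesis
    using assms by (induction S) (simp_all add: jury_trunc_0 jury_trunc_add)
qed

text \<open>Truncation respects sums, powers and scalars, so evaluation in
  \<open>jury_ring M N\<close> can be carried out among polynomials in x and y.\<close>

lemma poly_at_jury_trunc:
  "poly_at (jury_ring M N) p (jury_trunc M N P) =
     jury_trunc M N (\<Sum>k\<le>degree p. Polynomial.smult [:coeff p k:] (P ^ k))"
  by (simp add: poly_at_def jury_trunc_sum jury_trunc_smult jury_trunc_power)

text \<open>Without constant term, every factor \<open>B\<close> contributes total degree at least
  1. In the induction, a term either contains that zero constant term or leaves total degree below n
  for \<open>B ^ n\<close>.\<close>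

lemma coeff_power_low_degree_eq_0:
  fixes B :: "'a::comm_ring_1 poly poly"
  assumes "coeff (coeff B 0) 0 = 0" and "i + j < n"
  shows "coeff (coeff (B ^ n) i) j = 0"
  using assms(2)
proof (induction n arbitrary: i j)
  case (Suc n)
  have "coeff (coeff B l) k * coeff (coeff (B ^ n) (i - l)) (j - k) = 0"
    if "l \<le> i" "k \<le> j" for l k
  proof (cases "l = 0 \<and> k = 0")
    case False
    then have "(i - l) + (j - k) < n" using that Suc.prems by auto
    then show ?thesis by (simp add: Suc.IH)
  qed (use assms(1) in simp)
  then show ?case
    by (simp add: coeff_mult coeff_sum)
qed simp

text \<open>The binomial theorem, used to turn the coefficientwise evaluation of
  \<open>poly_at\<close> back into a power.\<close>

lemma sum_coeff_linear_power:
  fixes P :: "'a::comm_ring_1 poly poly"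
  shows "(\<Sum>k\<le>n. Polynomial.smult [:coeff ([:- a, 1:] ^ n) k:] (P ^ k)) = (P - [:[:a:]:]) ^ n"
proof -
  have const: "[:[:- a:]:] ^ m = [:[:(- a) ^ m:]:]" for m
    by (induction m) (simp_all add: one_pCons)
  have "P - [:[:a:]:] = P + [:[:- a:]:]"
    using diff_conv_add_uminus[of P "[:[:a:]:]"] by simp
  then have "(P - [:[:a:]:]) ^ n = (P + [:[:- a:]:]) ^ n"
    by (rule arg_cong)
  also have "\<dots> = (\<Sum>k\<le>n. of_nat (n choose k) * P ^ k * [:[:- a:]:] ^ (n - k))"
    by (rule binomial_ring)
  also have "\<dots> = (\<Sum>k\<le>n. Polynomial.smult [:coeff ([:- a, 1:] ^ n) k:] (P ^ k))"
    by (intro sum.cong refl)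
       (simp add: const coeff_linear_poly_power of_nat_poly mult.commute)
  finally show ?thesis by simp
qed

text \<open>The base is x + y, so its m-th power is homogeneous of degree m with binomial
  coefficients.\<close>

lemma coeff_power_x_plus_y:
  "coeff (coeff ([:[:0, 1:], 1:] ^ m) i) j =
     (if m = i + j then of_nat (m choose i) else (0 :: 'a::comm_ring_1))"
proof (cases "i \<le> m")
  case True
  have "coeff ([:[:0, 1:], 1:] ^ m) i = of_nat (m choose i) * monom (1::'a) (m - i)"
    using True by (simp add: coeff_linear_poly_power monom_altdef)
  with True show ?thesis by (auto simp: of_nat_poly)
next
  case False
  then have "degree ([:[:0, 1:], 1 :: 'a poly:] ^ m) < i"
    using degree_power_le[of "[:[:0, 1:], 1 :: 'a poly:]" m] by simp
  with False show ?thesis by (simp add: coeff_eq_0)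
qed

lemma jury_cayley_hamilton_poly:
  assumes "M \<ge> 1" and "N \<ge> 1" and "A \<in> carrier_mat M N"
  shows "cayley_hamilton_poly (jury_ring M N) (M + N - 1) A ([:- (A $$ (0, 0)), 1:] ^ (M + N - 1))"
proof -
  obtain P where P: "A = jury_trunc M N P"
    using assms(3) by (rule jury_trunc_surj)
  let ?a = "A $$ (0, 0)" and ?n = "M + N - 1"
  have deg: "degree ([:- ?a, 1:] ^ ?n) = ?n"
    by (simp add: degree_power_eq)
  have low: "coeff (coeff (P - [:[:?a:]:]) 0) 0 = 0"
    using assms by (simp add: P jury_trunc_index)
  have "poly_at (jury_ring M N) ([:- ?a, 1:] ^ ?n) A = jury_trunc M N ((P - [:[:?a:]:]) ^ ?n)"
    \<comment> \<open>Only the evaluation point is lifted to \<open>P\<close>; the \<open>A\<close>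
      inside \<open>?a\<close> stays.\<close>
    by (subst (2) P) (simp only: poly_at_jury_trunc deg sum_coeff_linear_power)
  also have "\<dots> = \<zero>\<^bsub>jury_ring M N\<^esub>"
    \<comment> \<open>A matrix position has i + j at most M + N - 2, one less than
      \<open>?n\<close>, so every entry vanishes.\<close>
    using coeff_power_low_degree_eq_0[OF low]
    by (auto simp: jury_ring_simps jury_trunc_def)
  finally show ?thesis
    using deg by (simp add: cayley_hamilton_poly_def coeff_linear_poly_power)
qed

lemma cayley_hamilton_at_jury_ring_lower_bound:
  assumes "M \<ge> 1" and "N \<ge> 1" and "cayley_hamilton_at (jury_ring M N) k"
  shows "M + N - 1 \<le> k"
proof (rule ccontr)
  assume "\<not> M + N - 1 \<le> k"
  \<comment> \<open>Picks a monomial of degree k, x to the i times y to the k - i, that fits in the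
    matrix: k is at most M + N - 2, so k - i stays below N.\<close>
  define i where "i = min k (M - 1)"
  have i: "i \<le> k" "i < M" "k - i < N"
    using \<open>\<not> M + N - 1 \<le> k\<close> assms by (auto simp: i_def)
  let ?P = "[:[:0, 1:], 1:]"
  obtain p where p: "lead_coeff p = 1" "degree p = k"
    and zero: "poly_at (jury_ring M N) p (jury_trunc M N ?P) = \<zero>\<^bsub>jury_ring M N\<^esub>"
    using assms(3) by (auto simp: cayley_hamilton_at_def cayley_hamilton_poly_def jury_ring_simps
        dest!: bspec[where x = "jury_trunc M N ?P"])
  have "0 = poly_at (jury_ring M N) p (jury_trunc M N ?P) $$ (i, k - i)"
    using i by (simp add: zero jury_ring_simps)
  also have "\<dots> = (\<Sum>m\<le>k. coeff p m * coeff (coeff (?P ^ m) i) (k - i))"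
    using i p by (simp add: poly_at_jury_trunc jury_trunc_index coeff_sum)
  \<comment> \<open>By homogeneity only the leading term of \<open>p\<close>, with coefficient 1,
    reaches this entry.\<close>
  also have "\<dots> = (\<Sum>m\<le>k. if m = k then of_nat (k choose i) else 0)"
    unfolding coeff_power_x_plus_y using i p by (intro sum.cong) auto
  also have "\<dots> = of_nat (k choose i)"
    by simp
  \<comment> \<open>The binomial coefficient is nonzero because i is at most k and the complex
    numbers have characteristic 0.\<close>
  finally show False
    using i by simp
qed

theorem theorem6:
  fixes M N :: nat
  assumes "M \<ge> 1" and "N \<ge> 1"
  shows "is_cayley_hamilton_degree (jury_ring M N) (M + N - 1) \<and>
         (\<forall>A\<in>carrier_mat M N.
            cayley_hamilton_poly (jury_ring M N) (M + N - 1) A ([:- (A $$ (0, 0)), 1:] ^ (M + N - 1)))"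
proof -
  have "cayley_hamilton_at (jury_ring M N) (M + N - 1)"
    using jury_cayley_hamilton_poly[OF assms]
    by (auto simp: cayley_hamilton_at_def jury_ring_simps)
  then show ?thesis
    using assms jury_cayley_hamilton_poly[OF assms]
      cayley_hamilton_at_jury_ring_lower_bound[OF assms]
    by (auto simp: is_cayley_hamilton_degree_def)
qed

end
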